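(* Let $F$ be a bipartite graph that contains a cycle. If $F$ contains a critical vertex $v$ such that the graph $F-v$ (obtained from $F$ by deleting $v$ and all edges incident to it) is connected, then $F$ is bounded.
   Context: For a graph $G$ on $n$ vertices, $\Delta(G)$ is its maximum degree and $\mathrm{ex}(n,F)$ is the maximum number of edges in an $n$-vertex graph containing no copy of $F$. A graph $F$ is $(\alpha,\beta)$-bounded (for reals $\alpha,\beta>0$) if there exists $N_0$ such that every graph $G$ on $n\ge N_0$ vertices with $\Delta(G)\ge \alpha (n-1)$ and $|E(G)|\ge (1-\beta)\,\mathrm{ex}(n,F)$ contains a copy of $F$. $F$ is bounded if it is $(\alpha,\beta)$-bounded for some constants $0<\alpha,\beta<1$. A bipartition $V(F)=V_1\cup V_2$ of a bipartite graph $F$ is proper if every edge of $F$ meets both $V_1$ and $V_2$; $F[V_1,V_2]$ denotes $F$ together with this ordered bipartition. For $v\in V_1$ (resp. $v\in V_2$), $F[V_1,V_2]-v$ denotes the graph $F-v$ with ordered bipartition $(V_1\setminus\{v\},V_2)$ (resp. $(V_1,V_2\setminus\{v\})$). A bipartite graph $G$ with ordered bipartition $(U_1,U_2)$ is ordered-$F[V_1,V_2]$-free if there is no copy of $F$ in $G$ with $V_1$ mapped into $U_1$ and $V_2$ mapped into $U_2$. The Zarankiewicz number $Z(m,n,F[V_1,V_2])$ is the maximum number of edges in an ordered-$F[V_1,V_2]$-free bipartite graph with ordered bipartition $(U_1,U_2)$, $|U_1|=m$, $|U_2|=n$. A vertex $v$ of a bipartite graph $F$ is critical if there is a proper bipartition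 $V(F)=V_1\cup V_2$ such that $\lim_{n\to\infty} Z(n,n,F[V_1,V_2]-v)/\mathrm{ex}(n,F)=0$. *)

theory Defs
  imports Complex_Main
begin

type_synonym 'a ugraph = "'a set \<times> 'a set set"

abbreviation verts :: "'a ugraph \<Rightarrow> 'a set" where
  "verts G \<equiv> fst G"

abbreviation edges :: "'a ugraph \<Rightarrow> 'a set set" where
  "edges G \<equiv> snd G"

definition simple_graph :: "'a ugraph \<Rightarrow> bool" where
  "simple_graph G \<longleftrightarrow> finite (verts G) \<and> (\<forall>e\<in>edges G. e \<subseteq> verts G \<and> card e = 2)"

definition vertex_degree :: "'a ugraph \<Rightarrow> 'a \<Rightarrow> nat" where
  "vertex_degree G v = card {e \<in> edges G. v \<in> e}"

(* The inserted 0 only matters for the graph without vertices. *)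
definition max_degree :: "'a ugraph \<Rightarrow> nat" where
  "max_degree G = Max (insert 0 (vertex_degree G ` verts G))"

definition delete_vertex :: "'a ugraph \<Rightarrow> 'a \<Rightarrow> 'a ugraph" where
  "delete_vertex G v = (verts G - {v}, {e \<in> edges G. v \<notin> e})"

definition graph_connected :: "'a ugraph \<Rightarrow> bool" where
  "graph_connected G \<longleftrightarrow>
     verts G \<noteq> {} \<and> (\<forall>u\<in>verts G. \<forall>w\<in>verts G. (u, w) \<in> {(x, y). {x, y} \<in> edges G}\<^sup>*)"

definition contains_cycle :: "'a ugraph \<Rightarrow> bool" where
  "contains_cycle G \<longleftrightarrow>
     (\<exists>c. length c \<ge> 3 \<and> distinct c \<and> set c \<subseteq> verts G \<and>
          (\<forall>i<length c. {c ! i, c ! (Suc i mod length c)} \<in> edges G))"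

(* Copies are not necessarily induced subgraphs. *)
definition contains_copy :: "'a ugraph \<Rightarrow> 'b ugraph \<Rightarrow> bool" where
  "contains_copy F G \<longleftrightarrow>
     (\<exists>f. inj_on f (verts F) \<and> f ` verts F \<subseteq> verts G \<and> (\<forall>e\<in>edges F. f ` e \<in> edges G))"

(* Host graphs have vertices in nat; up to isomorphism these are all finite graphs.
   The set below is always finite, and it is nonempty whenever F has an edge. *)
definition ex_number :: "nat \<Rightarrow> 'a ugraph \<Rightarrow> nat" where
  "ex_number n F =
     Max {card (edges G) | G :: nat ugraph.
            simple_graph G \<and> card (verts G) = n \<and> \<not> contains_copy F G}"

definition bounded_with :: "real \<Rightarrow> real \<Rightarrow> 'a ugraph \<Rightarrow> bool" where
  "bounded_with \<alpha> \<beta> F \<longleftrightarrow>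
     (\<exists>N0. \<forall>n\<ge>N0. \<forall>G :: nat ugraph.
        simple_graph G \<longrightarrow> card (verts G) = n \<longrightarrow>
        real (max_degree G) \<ge> \<alpha> * (real n - 1) \<longrightarrow>
        real (card (edges G)) \<ge> (1 - \<beta>) * real (ex_number n F) \<longrightarrow>
        contains_copy F G)"

definition bounded_graph :: "'a ugraph \<Rightarrow> bool" where
  "bounded_graph F \<longleftrightarrow>
     (\<exists>\<alpha> \<beta>. 0 < \<alpha> \<and> \<alpha> < 1 \<and> 0 < \<beta> \<and> \<beta> < 1 \<and> bounded_with \<alpha> \<beta> F)"

definition proper_bipartition :: "'a ugraph \<Rightarrow> 'a set \<Rightarrow> 'a set \<Rightarrow> bool" where
  "proper_bipartition G V1 V2 \<longleftrightarrow>
     V1 \<union> V2 = verts G \<and> V1 \<inter> V2 = {} \<and>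
     (\<forall>e\<in>edges G. e \<inter> V1 \<noteq> {} \<and> e \<inter> V2 \<noteq> {})"

definition bipartite :: "'a ugraph \<Rightarrow> bool" where
  "bipartite G \<longleftrightarrow> (\<exists>V1 V2. proper_bipartition G V1 V2)"

definition contains_ordered_copy ::
  "'a ugraph \<Rightarrow> 'a set \<Rightarrow> 'a set \<Rightarrow> 'b ugraph \<Rightarrow> 'b set \<Rightarrow> 'b set \<Rightarrow> bool" where
  "contains_ordered_copy F V1 V2 G U1 U2 \<longleftrightarrow>
     (\<exists>f. inj_on f (verts F) \<and> f ` V1 \<subseteq> U1 \<and> f ` V2 \<subseteq> U2 \<and>
          f ` verts F \<subseteq> verts G \<and> (\<forall>e\<in>edges F. f ` e \<in> edges G))"

definition zarankiewicz :: "nat \<Rightarrow> nat \<Rightarrow> 'a ugraph \<Rightarrow> 'a set \<Rightarrow> 'a set \<Rightarrow> nat" where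
  "zarankiewicz m n F V1 V2 =
     Max {card (edges G) | (G :: nat ugraph) U1 U2.
            simple_graph G \<and> proper_bipartition G U1 U2 \<and> card U1 = m \<and> card U2 = n \<and>
            \<not> contains_ordered_copy F V1 V2 G U1 U2}"

(* V1 and V2 are disjoint, so v is removed from exactly one of them. *)
definition critical_vertex :: "'a ugraph \<Rightarrow> 'a \<Rightarrow> bool" where
  "critical_vertex F v \<longleftrightarrow>
     v \<in> verts F \<and>
     (\<exists>V1 V2. proper_bipartition F V1 V2 \<and>
        (\<lambda>n. real (zarankiewicz n n (delete_vertex F v) (V1 - {v}) (V2 - {v}))
              / real (ex_number n F)) \<longlonglongrightarrow> 0)"

end

theory Submission
  imports Defs
begin

text \<open>
  Let \<open>G\<close> be \<open>F\<close>-free on \<open>n\<close> vertices with a vertex \<open>x\<close> of degree at least \<open>(n - 1) / 2\<close>, let \<open>N\<close> be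
  the neighbourhood of \<open>x\<close>, and write \<open>Z\<close> for the Zarankiewicz number of \<open>F - v\<close> in the critical
  bipartition, where \<open>v \<in> V\<^sub>1\<close>. Since \<open>x\<close> could play the role of \<open>v\<close>, no copy of \<open>F - v\<close> in \<open>G - x\<close>
  has its part \<open>V\<^sub>2\<close> inside \<open>N\<close>. Hence at most \<open>Z\<close> edges join \<open>N\<close> to the remaining vertices, and, by
  passing to a large cut, at most \<open>2 Z\<close> edges lie inside \<open>N\<close>. The edges that avoid \<open>N\<close> and \<open>x\<close> live on
  at most half of the vertices, so two disjoint copies of them show that they number at most
  \<open>ex(n, F) / 2\<close>. Finally \<open>x\<close> has degree below \<open>n \<le> Z\<close>: a perfect matching does not contain the
  connected graph \<open>F - v\<close>, which has at least three vertices. As \<open>Z = o(ex(n, F))\<close>, the graph \<open>G\<close> has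
  about at most half of the extremal number of edges.
\<close>

section \<open>Finiteness, and the extremal numbers as maxima\<close>

lemma simple_graph_finite_edges:
  assumes "simple_graph G"
  shows "finite (edges G)"
  using assms unfolding simple_graph_def
  by (meson PowI finite_Pow_iff finite_subset subsetI)

lemma simple_graph_edgeE:
  assumes "simple_graph G" "e \<in> edges G" "u \<in> e"
  obtains w where "e = {u, w}" "u \<noteq> w" "u \<in> verts G" "w \<in> verts G"
proof -
  have "card e = 2" "e \<subseteq> verts G" using assms by (auto simp: simple_graph_def)
  then obtain a b where ab: "e = {a, b}" "a \<noteq> b" by (meson card_2_iff)
  with assms(3) \<open>e \<subseteq> verts G\<close> that show thesis by (cases "u = a") auto
qed

text \<open>A crude bound suffices: it only serves to make the sets behind \<open>ex_number\<close>
  and \<open>zarankiewicz\<close> finite, so that \<open>Max\<close> is a genuine maximum.\<close>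

lemma card_edges_le_pow:
  assumes "simple_graph G" "card (verts G) = n"
  shows "card (edges G) \<le> 2 ^ n"
proof -
  have "edges G \<subseteq> Pow (verts G)" "finite (verts G)" using assms by (auto simp: simple_graph_def)
  then have "card (edges G) \<le> card (Pow (verts G))" by (intro card_mono) auto
  with \<open>finite (verts G)\<close> assms(2) show ?thesis by (simp add: card_Pow)
qed

lemma ex_number_ge:
  fixes G :: "nat ugraph"
  assumes "simple_graph G" "card (verts G) = n" "\<not> contains_copy F G"
  shows "card (edges G) \<le> ex_number n F"
  unfolding ex_number_def
proof (rule Max_ge)
  have "k \<le> 2 ^ n" if "k \<in> {card (edges G) | G :: nat ugraph.
      simple_graph G \<and> card (verts G) = n \<and> \<not> contains_copy F G}" for k
    using that card_edges_le_pow by (elim CollectE exE conjE) (simp only:)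
  then show "finite {card (edges G) | G :: nat ugraph.
      simple_graph G \<and> card (verts G) = n \<and> \<not> contains_copy F G}"
    by (meson finite_nat_set_iff_bounded_le)
qed (use assms in blast)

lemma zarankiewicz_ge:
  fixes G :: "nat ugraph"
  assumes "simple_graph G" "proper_bipartition G U1 U2" "card U1 = m" "card U2 = n"
    "\<not> contains_ordered_copy F V1 V2 G U1 U2"
  shows "card (edges G) \<le> zarankiewicz m n F V1 V2"
  unfolding zarankiewicz_def
proof (rule Max_ge)
  have bound: "card (edges G) \<le> 2 ^ (m + n)"
    if "simple_graph G" "proper_bipartition G U1 U2" "card U1 = m" "card U2 = n"
    for G :: "nat ugraph" and U1 U2
  proof (rule card_edges_le_pow)
    have "finite (U1 \<union> U2)" using that by (auto simp: proper_bipartition_def simple_graph_def)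
    with that show "card (verts G) = m + n"
      by (metis card_Un_disjoint finite_Un proper_bipartition_def)
  qed (fact that)
  have "k \<le> 2 ^ (m + n)" if "k \<in> {card (edges G) | (G :: nat ugraph) U1 U2.
            simple_graph G \<and> proper_bipartition G U1 U2 \<and> card U1 = m \<and> card U2 = n \<and>
            \<not> contains_ordered_copy F V1 V2 G U1 U2}" for k
    using that bound by (elim CollectE exE conjE) (simp only:)
  then show "finite {card (edges G) | (G :: nat ugraph) U1 U2.
            simple_graph G \<and> proper_bipartition G U1 U2 \<and> card U1 = m \<and> card U2 = n \<and>
            \<not> contains_ordered_copy F V1 V2 G U1 U2}"
    by (meson finite_nat_set_iff_bounded_le)
qed (use assms in blast)

lemma proper_bipartition_swap:
  "proper_bipartition G V1 V2 \<Longrightarrow> proper_bipartition G V2 V1"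
  unfolding proper_bipartition_def by auto

lemma contains_ordered_copy_swap:
  "contains_ordered_copy F V1 V2 G U1 U2 \<longleftrightarrow> contains_ordered_copy F V2 V1 G U2 U1"
  unfolding contains_ordered_copy_def by meson

lemma zarankiewicz_swap: "zarankiewicz m n F V1 V2 = zarankiewicz n m F V2 V1"
proof -
  have "{card (edges G) | (G :: nat ugraph) U1 U2.
            simple_graph G \<and> proper_bipartition G U1 U2 \<and> card U1 = m \<and> card U2 = n \<and>
            \<not> contains_ordered_copy F V1 V2 G U1 U2} =
        {card (edges G) | (G :: nat ugraph) U1 U2.
            simple_graph G \<and> proper_bipartition G U1 U2 \<and> card U1 = n \<and> card U2 = m \<and>
            \<not> contains_ordered_copy F V2 V1 G U1 U2}"
    using proper_bipartition_swap contains_ordered_copy_swap by blast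
  then show ?thesis unfolding zarankiewicz_def by simp
qed

section \<open>Connected graphs: propagation along edges, paths with two edges\<close>

lemma graph_connected_induct:
  assumes "graph_connected G" "u \<in> verts G" "w \<in> verts G" "P u"
    and "\<And>a b. {a, b} \<in> edges G \<Longrightarrow> P a \<Longrightarrow> P b"
  shows "P w"
proof -
  have "(u, w) \<in> {(x, y). {x, y} \<in> edges G}\<^sup>*"
    using assms(1-3) by (auto simp: graph_connected_def)
  then show ?thesis by (induction) (use assms(4,5) in auto)
qed

lemma connected_vertex_in_edge:
  assumes "graph_connected G" "2 \<le> card (verts G)" "u \<in> verts G"
  obtains w where "{u, w} \<in> edges G"
proof -
  have "\<not> verts G \<subseteq> {u}" using assms(2) by (auto dest: card_mono[rotated])
  then obtain z where "z \<in> verts G" "z \<noteq> u" by auto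
  with graph_connected_induct[OF assms(1,3), of z "\<lambda>y. y = u"] that show thesis by metis
qed

text \<open>If every vertex had at most one neighbour, an edge would be closed under adjacency and
  hence contain all vertices, which a third vertex contradicts.\<close>

lemma connected_cherry:
  assumes "graph_connected G" "3 \<le> card (verts G)"
  obtains a b c where "{a, b} \<in> edges G" "{a, c} \<in> edges G" "b \<noteq> c"
proof -
  obtain u where u: "u \<in> verts G" using assms(1) by (auto simp: graph_connected_def)
  obtain w where w: "{u, w} \<in> edges G"
    using connected_vertex_in_edge[OF assms(1) _ u] assms(2) by auto
  have "\<not> verts G \<subseteq> {u, w}"
  proof
    assume "verts G \<subseteq> {u, w}"
    then have "card (verts G) \<le> card {u, w}" by (rule card_mono[rotated]) simp
    also have "\<dots> \<le> 2" by (simp add: card_insert_le_m1)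
    finally show False using assms(2) by simp
  qed
  then obtain z where z: "z \<in> verts G" "z \<notin> {u, w}" by auto
  show thesis
  proof (rule ccontr)
    assume no: "\<not> thesis"
    have unique: "b = c" if "{a, b} \<in> edges G" "{a, c} \<in> edges G" for a b c
      using no \<open>\<And>a b c. \<lbrakk>{a, b} \<in> edges G; {a, c} \<in> edges G; b \<noteq> c\<rbrakk> \<Longrightarrow> thesis\<close> that by blast
    have wu: "{w, u} \<in> edges G" using w by (simp add: insert_commute)
    have "z \<in> {u, w}"
    proof (rule graph_connected_induct[OF assms(1) u z(1)])
      fix a b assume "{a, b} \<in> edges G" "a \<in> {u, w}"
      then show "b \<in> {u, w}" using unique[OF w, of b] unique[OF wu, of b] by auto
    qed simp
    with z show False by simp
  qed
qed

section \<open>Zarankiewicz numbers: a linear lower bound, and a bound on cuts\<close>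

text \<open>In the perfect matching that joins \<open>i\<close> to \<open>i + n\<close>, no vertex
  lies on two edges, so the two-edge path in \<open>F\<close> has no image. The bound later absorbs
  the degree of a single vertex into the Zarankiewicz number.\<close>

lemma zarankiewicz_ge_matching:
  assumes "graph_connected F" "3 \<le> card (verts F)"
    "V1 \<union> V2 = verts F" "\<And>e. e \<in> edges F \<Longrightarrow> e \<subseteq> verts F"
  shows "n \<le> zarankiewicz n n F V1 V2"
proof -
  define G :: "nat ugraph" where "G = ({..<2 * n}, (\<lambda>i. {i, i + n}) ` {..<n})"
  have inj: "inj_on (\<lambda>i. {i, i + n}) {..<n}" by (auto simp: inj_on_def doubleton_eq_iff)
  have "simple_graph G" by (auto simp: simple_graph_def G_def card_insert_if)
  moreover have "proper_bipartition G {..<n} {n..<2 * n}"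
    by (auto simp: proper_bipartition_def G_def)
  moreover have "\<not> contains_ordered_copy F V1 V2 G {..<n} {n..<2 * n}"
  proof
    assume "contains_ordered_copy F V1 V2 G {..<n} {n..<2 * n}"
    then obtain f where f: "inj_on f (verts F)" "\<And>e. e \<in> edges F \<Longrightarrow> f ` e \<in> edges G"
      by (auto simp: contains_ordered_copy_def)
    obtain a b c where abc: "{a, b} \<in> edges F" "{a, c} \<in> edges F" "b \<noteq> c"
      using connected_cherry[OF assms(1,2)] .
    obtain i j where "{f a, f b} = {i, i + n}" "{f a, f c} = {j, j + n}" "i < n" "j < n"
      using f(2)[OF abc(1)] f(2)[OF abc(2)] by (auto simp: G_def)
    \<comment> \<open>Since \<open>i\<close> and \<open>j\<close> are below \<open>n\<close>, the
      common point \<open>f a\<close> forces \<open>i = j\<close>.\<close>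
    then have "f b = f c" by (auto simp: doubleton_eq_iff)
    moreover have "b \<in> verts F" "c \<in> verts F" using assms(4) abc by blast+
    ultimately show False using f(1) abc(3) by (auto dest: inj_onD)
  qed
  ultimately have "card (edges G) \<le> zarankiewicz n n F V1 V2"
    by (intro zarankiewicz_ge) auto
  then show ?thesis using inj by (simp add: G_def card_image)
qed

text \<open>The Zarankiewicz number asks for parts of exactly \<open>n\<close> vertices, so
  \<open>A\<close> and \<open>B\<close> are padded with fresh natural numbers, and only the edges of
  the cut are kept. The padding is isolated, whereas every vertex of the connected \<open>F\<close>
  lies on an edge; so an ordered copy in the padded graph already lies in \<open>A\<close> and
  \<open>B\<close>.\<close>

lemma cut_le_zarankiewicz:
  fixes G :: "nat ugraph"
  assumes "simple_graph G" "card A \<le> n" "card B \<le> n" "A \<subseteq> verts G" "B \<subseteq> verts G" "A \<inter> B = {}"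
    and conn: "graph_connected F" "2 \<le> card (verts F)" "V1 \<union> V2 = verts F"
    and free: "\<not> contains_ordered_copy F V1 V2 G A B"
  shows "card {e \<in> edges G. e \<inter> A \<noteq> {} \<and> e \<inter> B \<noteq> {}} \<le> zarankiewicz n n F V1 V2"
proof -
  have fin: "finite A" "finite B"
    using assms(1,4,5) finite_subset by (auto simp: simple_graph_def)
  obtain A' where A': "finite A'" "card A' = n - card A" "A' \<subseteq> - (A \<union> B)"
    using infinite_arbitrarily_large[of "- (A \<union> B)"] fin
    by (metis finite_UnI finite_compl infinite_UNIV_nat)
  obtain B' where B': "finite B'" "card B' = n - card B" "B' \<subseteq> - (A \<union> A' \<union> B)"
    using infinite_arbitrarily_large[of "- (A \<union> A' \<union> B)"] fin A'
    by (metis finite_UnI finite_compl infinite_UNIV_nat)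
  define E where "E = {e \<in> edges G. e \<inter> A \<noteq> {} \<and> e \<inter> B \<noteq> {}}"
  have E: "e \<subseteq> A \<union> B \<and> card e = 2" if "e \<in> E" for e
  proof -
    from that obtain a where a: "a \<in> e" "a \<in> A" "e \<in> edges G" by (auto simp: E_def)
    obtain w where "e = {a, w}" "a \<noteq> w" by (rule simple_graph_edgeE[OF assms(1) a(3,1)])
    with that a assms(6) show ?thesis by (auto simp: E_def)
  qed
  define H where "H = ((A \<union> A') \<union> (B \<union> B'), E)"
  have "card (edges H) \<le> zarankiewicz n n F V1 V2"
  proof (rule zarankiewicz_ge)
    show "simple_graph H" using E fin A' B' by (auto simp: simple_graph_def H_def)
    show "proper_bipartition H (A \<union> A') (B \<union> B')"
      using assms(6) A'(3) B'(3) by (auto simp: proper_bipartition_def H_def E_def)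
    show "card (A \<union> A') = n" using fin A' assms(2) by (subst card_Un_disjoint) auto
    show "card (B \<union> B') = n" using fin B' assms(3) by (subst card_Un_disjoint) auto
    show "\<not> contains_ordered_copy F V1 V2 H (A \<union> A') (B \<union> B')"
    proof
      assume "contains_ordered_copy F V1 V2 H (A \<union> A') (B \<union> B')"
      then obtain f where f: "inj_on f (verts F)" "f ` V1 \<subseteq> A \<union> A'" "f ` V2 \<subseteq> B \<union> B'"
        "\<And>e. e \<in> edges F \<Longrightarrow> f ` e \<in> E"
        by (auto simp: contains_ordered_copy_def H_def)
      have AB: "f w \<in> A \<union> B" if w: "w \<in> verts F" for w
      proof -
        obtain y where "{w, y} \<in> edges F" using connected_vertex_in_edge[OF conn(1,2) w] .
        then have "f ` {w, y} \<subseteq> A \<union> B" using f(4) E by blast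
        then show ?thesis by simp
      qed
      have "f ` V1 \<subseteq> A"
      proof
        fix y assume "y \<in> f ` V1"
        then have "y \<in> A \<union> B" "y \<in> A \<union> A'" using AB f(2) conn(3) by auto
        then show "y \<in> A" using A'(3) assms(6) by auto
      qed
      moreover have "f ` V2 \<subseteq> B"
      proof
        fix y assume "y \<in> f ` V2"
        then have "y \<in> A \<union> B" "y \<in> B \<union> B'" using AB f(3) conn(3) by auto
        then show "y \<in> B" using B'(3) assms(6) by auto
      qed
      moreover from calculation have "f ` verts F \<subseteq> verts G" using assms(4,5) unfolding conn(3)[symmetric] image_Un by auto
      moreover have "\<forall>e\<in>edges F. f ` e \<in> edges G" using f(4) by (simp add: E_def)
      ultimately have "contains_ordered_copy F V1 V2 G A B"
        unfolding contains_ordered_copy_def using f(1) by (intro exI[of _ f] conjI)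
      with free show False ..
    qed
  qed
  then show ?thesis by (simp add: H_def E_def)
qed

section \<open>Cuts that contain at least half of the edges\<close>

text \<open>Greedy placement: a new vertex \<open>w\<close> goes opposite to the majority of its
  neighbours. \<open>D\<close> and \<open>D'\<close> are the edges from \<open>w\<close> to the two
  sides of the old cut, and the larger class becomes cut.\<close>

lemma exists_large_cut:
  assumes "finite V" "\<And>e. e \<in> E \<Longrightarrow> e \<subseteq> V \<and> card e = 2"
  shows "\<exists>A\<subseteq>V. card E \<le> 2 * card {e \<in> E. e \<inter> A \<noteq> {} \<and> e \<inter> (V - A) \<noteq> {}}"
  using assms
proof (induction V arbitrary: E)
  case empty
  then have "E = {}" by fastforce
  then show ?case by simp
next
  case (insert w V)
  define E0 where "E0 = {e \<in> E. w \<notin> e}"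
  have finE: "finite E" using insert.prems insert.hyps(1)
    by (intro finite_subset[of E "Pow (insert w V)"]) auto
  obtain A where A: "A \<subseteq> V" "card E0 \<le> 2 * card {e \<in> E0. e \<inter> A \<noteq> {} \<and> e \<inter> (V - A) \<noteq> {}}"
    using insert.IH[of E0] insert.prems by (auto simp: E0_def)
  define C where "C = {e \<in> E0. e \<inter> A \<noteq> {} \<and> e \<inter> (V - A) \<noteq> {}}"
  define D where "D = {e \<in> E. w \<in> e \<and> e \<inter> A \<noteq> {}}"
  define D' where "D' = {e \<in> E. w \<in> e \<and> e \<inter> (V - A) \<noteq> {}}"
  have "e \<in> D \<union> D'" if "e \<in> E" "w \<in> e" for e
  proof -
    have "card e = 2" "e \<subseteq> insert w V" using insert.prems that by auto
    then obtain u where "u \<in> e" "u \<noteq> w" by (metis card_2_iff insertI1 insertI2)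
    with that \<open>e \<subseteq> insert w V\<close> show ?thesis by (auto simp: D_def D'_def)
  qed
  then have "E \<subseteq> E0 \<union> (D \<union> D')" by (auto simp: E0_def)
  moreover have fin: "finite E0" "finite C" "finite D" "finite D'"
    using finE by (auto simp: E0_def C_def D_def D'_def)
  ultimately have "card E \<le> card (E0 \<union> (D \<union> D'))" by (intro card_mono) auto
  also have "\<dots> \<le> card E0 + (card D + card D')"
    by (meson add_left_mono card_Un_le le_trans)
  finally have le: "card E \<le> 2 * card C + (card D + card D')" using A(2) by (simp add: C_def)
  have disj: "card (C \<union> D) = card C + card D" "card (C \<union> D') = card C + card D'"
    using fin by (auto intro!: card_Un_disjoint simp: C_def D_def D'_def E0_def)
  show ?case
  proof (cases "card D' \<le> card D")
    case True
    have "card (C \<union> D) \<le> card {e \<in> E. e \<inter> A \<noteq> {} \<and> e \<inter> (insert w V - A) \<noteq> {}}"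
      using finE insert.hyps(2) A(1) by (intro card_mono) (auto simp: C_def D_def E0_def)
    with le disj True A(1) show ?thesis by (intro exI[of _ A]) auto
  next
    case False
    have "card (C \<union> D') \<le>
        card {e \<in> E. e \<inter> insert w A \<noteq> {} \<and> e \<inter> (insert w V - insert w A) \<noteq> {}}"
      using finE insert.hyps(2) A(1) by (intro card_mono) (auto simp: C_def D'_def E0_def)
    with le disj False A(1) show ?thesis by (intro exI[of _ "insert w A"]) auto
  qed
qed

section \<open>Doubling a small F-free graph\<close>

text \<open>Two disjoint copies of \<open>G\<close>, filled up with isolated vertices, form an
  \<open>F\<close>-free graph on \<open>n\<close> vertices. In a copy of \<open>F\<close> there, the
  connected graph \<open>F - v\<close> would stay inside one copy of \<open>G\<close>. If
  \<open>v\<close> has an edge, it follows into the same copy; otherwise it can be moved to a spare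
  vertex of \<open>G\<close>. Either way \<open>F\<close> would embed into \<open>G\<close>.\<close>

lemma double_edges_le_ex_number:
  fixes G :: "nat ugraph"
  assumes G: "simple_graph G" "card (verts G) = m" "\<not> contains_copy F G" "2 * m \<le> n"
    and F: "simple_graph F" "card (verts F) \<le> m" "v \<in> verts F"
    and conn: "graph_connected (delete_vertex F v)" "2 \<le> card (verts (delete_vertex F v))"
  shows "2 * card (edges G) \<le> ex_number n F"
proof -
  \<comment> \<open>The parity of a number tells which copy of \<open>G\<close> it belongs to, and
    halving it recovers the vertex of \<open>G\<close>.\<close>
  define h :: "nat \<Rightarrow> nat \<Rightarrow> nat" where "h = (\<lambda>c x. 2 * x + c)"
  have hdiv: "h c x div 2 = x" and hmod: "h c x mod 2 = c" if "c < 2" for c x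
    using that by (auto simp: h_def)
  have injh: "inj (h c)" for c by (auto simp: h_def inj_def)
  have finG: "finite (verts G)" using G(1) by (simp add: simple_graph_def)
  define W where "W = h 0 ` verts G \<union> h 1 ` verts G"
  have finW: "finite W" using finG by (simp add: W_def)
  have h01: "h 0 x \<noteq> h 1 y" for x y unfolding h_def by presburger
  then have "h 0 ` verts G \<inter> h 1 ` verts G = {}" by blast
  then have cW: "card W = 2 * m"
    using finG G(2) injh by (simp add: W_def card_Un_disjoint card_image inj_on_subset[OF _ subset_UNIV])
  obtain X where X: "finite X" "card X = n - 2 * m" "X \<subseteq> - W"
    using infinite_arbitrarily_large[of "- W"] finW by (metis finite_compl infinite_UNIV_nat)
  define E where "E = (`) (h 0) ` edges G \<union> (`) (h 1) ` edges G"
  have EE: "\<exists>c\<in>{0, 1}. \<exists>d\<in>edges G. e = h c ` d" if "e \<in> E" for e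
    using that unfolding E_def by blast
  have ne: "d \<noteq> {}" if "d \<in> edges G" for d using that G(1) by (auto simp: simple_graph_def)
  \<comment> \<open>Nonemptiness matters here: the empty set has the same image under both
    maps.\<close>
  have "h 0 ` d \<noteq> h 1 ` d'" if "d \<noteq> {}" for d d'
  proof
    assume eq: "h 0 ` d = h 1 ` d'"
    from that obtain y where "y \<in> d" by auto
    then have "h 0 y \<in> h 1 ` d'" using eq by blast
    then show False using h01 by blast
  qed
  with ne have "(`) (h 0) ` edges G \<inter> (`) (h 1) ` edges G = {}" by blast
  moreover have "inj ((`) (h c))" for c using injh by (simp add: inj_image_eq_iff inj_def)
  ultimately have cE: "card E = 2 * card (edges G)"
    using simple_graph_finite_edges[OF G(1)]
    by (simp add: E_def card_Un_disjoint card_image inj_on_subset[OF _ subset_UNIV])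
  define H where "H = (W \<union> X, E)"
  have "simple_graph H"
  proof -
    have "e \<subseteq> W \<and> card e = 2" if e: "e \<in> E" for e
    proof -
      obtain c d where cd: "c \<in> {0, 1}" "d \<in> edges G" "e = h c ` d" using EE[OF e] by blast
      then have "d \<subseteq> verts G" "card d = 2" using G(1) by (auto simp: simple_graph_def)
      with cd injh show ?thesis
        unfolding W_def by (auto simp: card_image inj_on_subset[OF _ subset_UNIV])
    qed
    then show ?thesis using finW X(1) by (auto simp: simple_graph_def H_def)
  qed
  moreover have "card (verts H) = n"
    using finW X cW G(4) by (simp add: H_def) (subst card_Un_disjoint, auto)
  moreover have "\<not> contains_copy F H"
  proof
    assume "contains_copy F H"
    then obtain f where f: "inj_on f (verts F)" "\<And>e. e \<in> edges F \<Longrightarrow> f ` e \<in> E"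
      by (auto simp: contains_copy_def H_def)
    define F' where "F' = delete_vertex F v"
    have F': "verts F' = verts F - {v}" "edges F' \<subseteq> edges F" by (auto simp: F'_def delete_vertex_def)
    obtain u where u: "u \<in> verts F'" using conn(1) by (auto simp: F'_def graph_connected_def)
    define g where "g = (\<lambda>y. f y div 2)"
    have parity: "f a mod 2 = f b mod 2" "g ` e \<in> edges G"
      if e: "e \<in> edges F" "a \<in> e" "b \<in> e" for e a b
    proof -
      obtain c d where "c \<in> {0, 1}" and cd': "d \<in> edges G" "f ` e = h c ` d"
        using EE[OF f(2)[OF e(1)]] by blast
      then have "c < 2" by auto
      note cd = this cd'
      have "f a \<in> h c ` d" "f b \<in> h c ` d" using e cd(3) by blast+
      then show "f a mod 2 = f b mod 2" using hmod[OF cd(1)] by auto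
      have "g ` e = (\<lambda>y. y div 2) ` f ` e" by (simp only: g_def image_image)
      also have "\<dots> = d" using hdiv[OF cd(1)] by (simp add: cd(3) image_image)
      finally show "g ` e \<in> edges G" using cd(2) by simp
    qed
    \<comment> \<open>Adjacent vertices have images of equal parity, so connectedness confines all
      of \<open>F - v\<close> to one copy.\<close>
    have par: "f y mod 2 = f u mod 2" if "y \<in> verts F'" for y
      using conn(1) u that unfolding F'_def
    proof (rule graph_connected_induct)
      fix a b assume "{a, b} \<in> edges (delete_vertex F v)" "f a mod 2 = f u mod 2"
      moreover from this have "{a, b} \<in> edges F" by (auto simp: delete_vertex_def)
      ultimately show "f b mod 2 = f u mod 2" using parity(1)[of "{a, b}" a b] by simp
    qed simp
    \<comment> \<open>Halving identifies the two copies, so it is injective only where the parity is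
      constant.\<close>
    have injg: "inj_on g S" if "S \<subseteq> verts F" "\<And>y. y \<in> S \<Longrightarrow> f y mod 2 = f u mod 2" for S
    proof (rule inj_onI)
      fix y z assume yz: "y \<in> S" "z \<in> S" "g y = g z"
      then have "f y mod 2 = f z mod 2" using that(2) by simp
      with yz(3) have "f y = f z" unfolding g_def by (metis div_mult_mod_eq)
      then show "y = z" using f(1) that(1) yz by (auto dest: inj_onD)
    qed
    have gE: "g ` e \<in> edges G" if "e \<in> edges F" for e
    proof -
      have "card e = 2" using that F(1) by (simp add: simple_graph_def)
      then obtain a where "a \<in> e" by fastforce
      with that parity(2) show ?thesis by blast
    qed
    have gV: "g y \<in> verts G" if "e \<in> edges F" "y \<in> e" for e y
    proof -
      have "g ` e \<subseteq> verts G" using gE[OF that(1)] G(1) by (auto simp: simple_graph_def)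
      with that show ?thesis by auto
    qed
    \<comment> \<open>Every vertex of \<open>F - v\<close> lies on an edge, so none is sent to the
      isolated filling \<open>X\<close>.\<close>
    have gF': "g ` verts F' \<subseteq> verts G"
    proof
      fix y assume "y \<in> g ` verts F'"
      then obtain z where z: "z \<in> verts F'" "y = g z" by auto
      obtain w where "{z, w} \<in> edges F'" by (rule connected_vertex_in_edge[OF conn, folded F'_def, OF z(1)])
      with gV z(2) F'(2) show "y \<in> verts G" by blast
    qed
    show False
    proof (cases "\<exists>e\<in>edges F. v \<in> e")
      case True
      then obtain e where e: "e \<in> edges F" "v \<in> e" by auto
      obtain w where w: "e = {v, w}" "v \<noteq> w" "w \<in> verts F"
        by (rule simple_graph_edgeE[OF F(1) e])
      have "f v mod 2 = f u mod 2" using parity(1)[OF e(1), of v w] par[of w] w F'(1) by simp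
      with par F'(1) have "inj_on g (verts F)" by (intro injg) auto
      moreover have "g ` verts F \<subseteq> verts G" using gF' gV[OF e] F'(1) by auto
      ultimately show False using G(3) gE unfolding contains_copy_def by blast
    next
      case False
      have "finite (verts F)" using F(1) by (simp add: simple_graph_def)
      then have finF': "finite (verts F')" and "card (verts F') < m"
        using F(2) card_Diff1_less[OF _ F(3)] F'(1) by auto
      moreover have "card (g ` verts F') \<le> card (verts F')" using finF' by (rule card_image_le)
      ultimately have "\<not> verts G \<subseteq> g ` verts F'"
        using G(2) card_mono[of "g ` verts F'" "verts G"] by auto
      then obtain x where x: "x \<in> verts G" "x \<notin> g ` verts F'" by auto
      define k where "k = g(v := x)"
      have kg: "k y = g y" if "y \<noteq> v" for y using that by (simp add: k_def)
      have "inj_on g (verts F')" using par F'(1) by (intro injg) auto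
      then have "inj_on k (verts F)" using x(2) F'(1) by (auto simp: k_def inj_on_def)
      moreover have "k ` verts F \<subseteq> verts G" using gF' x(1) F'(1) by (auto simp: k_def)
      moreover have "k ` e \<in> edges G" if "e \<in> edges F" for e
      proof -
        have "k ` e = g ` e" using False that by (intro image_cong) (auto simp: k_def)
        then show ?thesis using gE[OF that] by simp
      qed
      ultimately show False using G(3) unfolding contains_copy_def by blast
    qed
  qed
  ultimately show ?thesis using ex_number_ge[of H n F] cE by (simp add: H_def)
qed

section \<open>Counting edges around a vertex of large degree\<close>

text \<open>Sending \<open>v\<close> to \<open>x\<close> completes the copy: all neighbours of
  \<open>v\<close> lie in \<open>V2\<close>, whose image consists of neighbours of \<open>x\<close>.
  As \<open>x\<close> is outside \<open>A\<close> and \<open>B\<close>, the map stays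
  injective.\<close>

lemma contains_copy_if_ordered_copy_in_neighbourhood:
  assumes "proper_bipartition F V1 V2" "simple_graph F" "v \<in> V1" "x \<in> verts G" "x \<notin> A" "x \<notin> B"
    and B: "\<And>b. b \<in> B \<Longrightarrow> {x, b} \<in> edges G"
    and "contains_ordered_copy (delete_vertex F v) (V1 - {v}) V2 G A B"
  shows "contains_copy F G"
proof -
  have V: "verts F = V1 \<union> V2" "V1 \<inter> V2 = {}" using assms(1) by (auto simp: proper_bipartition_def)
  obtain f where f: "inj_on f (verts F - {v})" "f ` (V1 - {v}) \<subseteq> A" "f ` V2 \<subseteq> B"
    "f ` (verts F - {v}) \<subseteq> verts G" "\<And>e. e \<in> edges F \<Longrightarrow> v \<notin> e \<Longrightarrow> f ` e \<in> edges G"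
    using assms(8) by (auto simp: contains_ordered_copy_def delete_vertex_def)
  define k where "k = f(v := x)"
  have "x \<notin> f ` (verts F - {v})" using f(2,3) V assms(5,6) by blast
  with f(1) have "inj_on k (verts F)" by (auto simp: k_def inj_on_def)
  moreover have "k ` verts F \<subseteq> verts G" using f(4) assms(4) by (auto simp: k_def)
  moreover have "k ` e \<in> edges G" if e: "e \<in> edges F" for e
  proof (cases "v \<in> e")
    case True
    obtain w where w: "e = {v, w}" "v \<noteq> w" by (rule simple_graph_edgeE[OF assms(2) e True])
    have "e \<inter> V2 \<noteq> {}" using assms(1) e by (auto simp: proper_bipartition_def)
    with w V assms(3) have "w \<in> V2" by auto
    then have "{x, f w} \<in> edges G" using f(3) B by blast
    moreover have "k ` e = {x, f w}" using w by (auto simp: k_def)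
    ultimately show ?thesis by simp
  next
    case False
    then have "k ` e = f ` e" by (intro image_cong) (auto simp: k_def)
    then show ?thesis using f(5) e False by simp
  qed
  ultimately show ?thesis unfolding contains_copy_def by blast
qed

text \<open>The edges are covered by four classes: at most \<open>n\<close> at \<open>x\<close>, at
  most half of \<open>ex_number n F\<close> inside \<open>W\<close>, at most twice the Zarankiewicz
  number inside \<open>N\<close>, and at most once that number between \<open>R\<close> and
  \<open>N\<close>. Doubling the sum gives the coefficients 1, 6 and 2.\<close>

lemma edge_bound_large_degree:
  fixes G :: "nat ugraph"
  assumes G: "simple_graph G" "card (verts G) = n" "\<not> contains_copy F G"
    and deg: "n \<le> 2 * max_degree G + 1" and n: "2 * card (verts F) \<le> n" "0 < n"
    and F: "simple_graph F" "proper_bipartition F V1 V2" "v \<in> V1"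
    and conn: "graph_connected (delete_vertex F v)" "2 \<le> card (verts (delete_vertex F v))"
  shows "2 * card (edges G) \<le>
    ex_number n F + 6 * zarankiewicz n n (delete_vertex F v) (V1 - {v}) V2 + 2 * n"
proof -
  let ?F = "delete_vertex F v"
  let ?Z = "zarankiewicz n n ?F (V1 - {v}) V2"
  have finV: "finite (verts G)" and finE: "finite (edges G)"
    using G(1) simple_graph_finite_edges[OF G(1)] by (auto simp: simple_graph_def)
  have vF: "(V1 - {v}) \<union> V2 = verts ?F" "v \<in> verts F"
    using F by (auto simp: delete_vertex_def proper_bipartition_def)
  have "max_degree G \<in> insert 0 (vertex_degree G ` verts G)"
    unfolding max_degree_def using finV by (intro Max_in) auto
  \<comment> \<open>Should the maximum be the inserted 0, any vertex can serve as
    \<open>x\<close>.\<close>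
  moreover obtain y where "y \<in> verts G" using n(2) G(2) by fastforce
  ultimately obtain x where x: "x \<in> verts G" "max_degree G \<le> vertex_degree G x" by auto
  define N where "N = {y. {x, y} \<in> edges G}"
  have N: "N \<subseteq> verts G" "x \<notin> N"
    using G(1) by (auto simp: N_def simple_graph_def)
  then have finN: "finite N" using finV finite_subset by blast
  have Ex: "{e \<in> edges G. x \<in> e} = (\<lambda>y. {x, y}) ` N"
  proof
    show "{e \<in> edges G. x \<in> e} \<subseteq> (\<lambda>y. {x, y}) ` N"
    proof
      fix e assume "e \<in> {e \<in> edges G. x \<in> e}"
      then have e: "e \<in> edges G" "x \<in> e" by auto
      obtain w where "e = {x, w}" by (rule simple_graph_edgeE[OF G(1) e])
      with e(1) show "e \<in> (\<lambda>y. {x, y}) ` N" by (auto simp: N_def)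
    qed
  qed (auto simp: N_def)
  then have degN: "vertex_degree G x \<le> card N"
    unfolding vertex_degree_def using card_image_le[OF finN] by metis
  have free: "\<not> contains_ordered_copy ?F (V1 - {v}) V2 G A B" if "x \<notin> A" "B \<subseteq> N" for A B
  proof
    have "x \<notin> B" "\<And>b. b \<in> B \<Longrightarrow> {x, b} \<in> edges G" using that(2) N(2) by (auto simp: N_def)
    moreover assume "contains_ordered_copy ?F (V1 - {v}) V2 G A B"
    ultimately have "contains_copy F G"
      by (rule contains_copy_if_ordered_copy_in_neighbourhood[OF F(2,1,3) x(1) that(1)])
    with G(3) show False ..
  qed
  have bound: "card {e \<in> edges G. e \<inter> A \<noteq> {} \<and> e \<inter> B \<noteq> {}} \<le> ?Z"
    if "A \<subseteq> verts G - {x}" "B \<subseteq> N" "A \<inter> B = {}" for A B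
  proof (rule cut_le_zarankiewicz[OF G(1) _ _ _ _ _ conn vF(1)])
    show "A \<subseteq> verts G" "B \<subseteq> verts G" using that N by auto
    then show "card A \<le> n" "card B \<le> n" using G(2) finV by (auto intro: card_mono)
    show "\<not> contains_ordered_copy ?F (V1 - {v}) V2 G A B" using that by (intro free) auto
  qed (fact that)
  define R where "R = verts G - {x} - N"
  have "card (insert x N) = Suc (card N)" using N finN by simp
  moreover have "R = verts G - insert x N" by (auto simp: R_def)
  ultimately have "card R = n - Suc (card N)"
    using G(2) N x(1) finN by (simp add: card_Diff_subset)
  then have "card R \<le> n div 2" using deg x(2) degN by linarith
  \<comment> \<open>\<open>R\<close> may have fewer vertices than \<open>F\<close>, but the doubling
    argument needs at least that many. Enlarging \<open>R\<close> to exactly \<open>n div 2\<close>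
    vertices is harmless, since the edge classes may overlap.\<close>
  then obtain W where W: "R \<subseteq> W" "W \<subseteq> verts G" "card W = n div 2"
    using exists_subset_between[of R "n div 2" "verts G"] finV G(2) by (auto simp: R_def)
  define EW where "EW = {e \<in> edges G. e \<subseteq> W}"
  have EW: "2 * card EW \<le> ex_number n F"
  proof -
    have "2 * card (edges (W, EW)) \<le> ex_number n F"
    proof (rule double_edges_le_ex_number[where m = "n div 2", OF _ _ _ _ F(1) _ vF(2) conn])
      show "simple_graph (W, EW)"
        using G(1) finite_subset[OF W(2) finV] by (auto simp: simple_graph_def EW_def)
      show "\<not> contains_copy F (W, EW)"
        using G(3) W(2) unfolding contains_copy_def EW_def by fastforce
    qed (use W n in auto)
    then show ?thesis by simp
  qed
  define EN where "EN = {e \<in> edges G. e \<subseteq> N}"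
  obtain A where A: "A \<subseteq> N" "card EN \<le> 2 * card {e \<in> EN. e \<inter> A \<noteq> {} \<and> e \<inter> (N - A) \<noteq> {}}"
    using exists_large_cut[OF finN, of EN] G(1) by (auto simp: EN_def simple_graph_def)
  have "card {e \<in> EN. e \<inter> A \<noteq> {} \<and> e \<inter> (N - A) \<noteq> {}}
      \<le> card {e \<in> edges G. e \<inter> A \<noteq> {} \<and> e \<inter> (N - A) \<noteq> {}}"
    using finE by (intro card_mono) (auto simp: EN_def)
  also have "\<dots> \<le> ?Z" using A N by (intro bound) auto
  finally have EN: "card EN \<le> 2 * ?Z" using A(2) by linarith
  define ER where "ER = {e \<in> edges G. e \<inter> R \<noteq> {} \<and> e \<inter> N \<noteq> {}}"
  have ER: "card ER \<le> ?Z" unfolding ER_def by (intro bound) (auto simp: R_def)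
  have Exn: "card {e \<in> edges G. x \<in> e} \<le> n"
    unfolding Ex using card_image_le[OF finN] card_mono[OF finV N(1)] G(2) by (metis le_trans)
  have "edges G \<subseteq> {e \<in> edges G. x \<in> e} \<union> EW \<union> EN \<union> ER"
  proof
    fix e assume e: "e \<in> edges G"
    then have "e \<subseteq> verts G" using G(1) by (auto simp: simple_graph_def)
    show "e \<in> {e \<in> edges G. x \<in> e} \<union> EW \<union> EN \<union> ER"
    proof (cases "x \<in> e \<or> e \<subseteq> N \<or> e \<subseteq> R")
      case True
      then show ?thesis using e W(1) by (auto simp: EW_def EN_def)
    next
      case False
      then show ?thesis using e \<open>e \<subseteq> verts G\<close> unfolding ER_def R_def by blast
    qed
  qed
  then have "card (edges G) \<le> card ({e \<in> edges G. x \<in> e} \<union> EW \<union> EN \<union> ER)"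
    using finE by (intro card_mono) (auto simp: EW_def EN_def ER_def)
  also have "\<dots> \<le> card {e \<in> edges G. x \<in> e} + card EW + card EN + card ER"
    by (meson add_mono card_Un_le le_trans order_refl)
  finally show ?thesis using Exn EW EN ER by linarith
qed

section \<open>Asymptotics and the choice of constants\<close>

text \<open>Sides alternate along edges, which rules out a triangle, so the cycle has length at
  least 4. This leaves at least three vertices in \<open>F - v\<close>.\<close>

lemma bipartite_cycle_card_verts:
  assumes "simple_graph F" "proper_bipartition F V1 V2" "contains_cycle F"
  shows "4 \<le> card (verts F)"
proof -
  obtain c where c: "length c \<ge> 3" "distinct c" "set c \<subseteq> verts F"
    "\<And>i. i < length c \<Longrightarrow> {c ! i, c ! (Suc i mod length c)} \<in> edges F"
    using assms(3) by (auto simp: contains_cycle_def)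
  have "length c \<noteq> 3"
  proof
    assume l: "length c = 3"
    have "{c ! 0, c ! 1} \<in> edges F" "{c ! 1, c ! 2} \<in> edges F" "{c ! 2, c ! 0} \<in> edges F"
      using c(4)[of 0] c(4)[of 1] c(4)[of 2] l by (simp_all add: numeral_2_eq_2)
    moreover have "a \<in> V1 \<longleftrightarrow> b \<notin> V1" if "{a, b} \<in> edges F" for a b
      using that assms(2) by (auto simp: proper_bipartition_def)
    ultimately show False by blast
  qed
  moreover have "card (set c) \<le> card (verts F)"
    using c(3) assms(1) by (intro card_mono) (auto simp: simple_graph_def)
  ultimately show ?thesis using c(1,2) by (simp add: distinct_card)
qed

theorem theorem1p3:
  fixes F :: "'a ugraph" and v :: 'a
  assumes "simple_graph F" and "bipartite F" and "contains_cycle F"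
    and "critical_vertex F v" and "graph_connected (delete_vertex F v)"
  shows "bounded_graph F"
proof -
  let ?F = "delete_vertex F v"
  obtain V1 V2 where V: "proper_bipartition F V1 V2" "v \<in> V1"
    and lim: "(\<lambda>n. real (zarankiewicz n n ?F (V1 - {v}) V2) / real (ex_number n F)) \<longlonglongrightarrow> 0"
  proof -
    obtain V1 V2 where V: "v \<in> verts F" "proper_bipartition F V1 V2" and
      lim: "(\<lambda>n. real (zarankiewicz n n ?F (V1 - {v}) (V2 - {v})) / real (ex_number n F)) \<longlonglongrightarrow> 0"
      using assms(4) by (auto simp: critical_vertex_def)
    show thesis
    proof (cases "v \<in> V1")
      case True
      then have "V2 - {v} = V2" using V by (auto simp: proper_bipartition_def)
      with that[OF V(2) True] lim show thesis by simp
    next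
      case False
      then have "v \<in> V2" "V1 - {v} = V1" using V by (auto simp: proper_bipartition_def)
      \<comment> \<open>With both parts of size \<open>n\<close>, swapping the parts of the pattern
        keeps the Zarankiewicz number, so \<open>v\<close> may be assumed to lie in the first
        part.\<close>
      with that[OF proper_bipartition_swap[OF V(2)]] lim zarankiewicz_swap[of _ _ ?F "V1 - {v}"]
      show thesis by simp
    qed
  qed
  let ?Z = "\<lambda>n. zarankiewicz n n ?F (V1 - {v}) V2"
  have VF: "(V1 - {v}) \<union> V2 = verts ?F" "v \<in> verts F"
    using V by (auto simp: delete_vertex_def proper_bipartition_def)
  have finF: "finite (verts F)" using assms(1) by (simp add: simple_graph_def)
  have card3: "3 \<le> card (verts ?F)"
    using bipartite_cycle_card_verts[OF assms(1) V(1) assms(3)] VF(2) finF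
    by (simp add: delete_vertex_def)
  have nZ: "n \<le> ?Z n" for n
    by (rule zarankiewicz_ge_matching[OF assms(5) card3 VF(1)])
      (use assms(1) in \<open>auto simp: delete_vertex_def simple_graph_def\<close>)
  \<comment> \<open>A quotient with denominator 0 is 0, so the limit says something about the
    numerator only where the extremal number is positive. A host with a single edge shows this, as
    \<open>F\<close> has two edges.\<close>
  have ex_pos: "0 < ex_number n F" if "2 \<le> n" for n
  proof -
    define G :: "nat ugraph" where "G = ({..<n}, {{0, 1}})"
    have "edges G = {{0, 1}}" by (simp add: G_def)
    have "\<not> contains_copy F G"
    proof
      assume "contains_copy F G"
      then obtain f :: "'a \<Rightarrow> nat"
        where f: "inj_on f (verts F)" "\<And>e. e \<in> edges F \<Longrightarrow> f ` e = {0, 1}"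
        using \<open>edges G = {{0, 1}}\<close> unfolding contains_copy_def by (metis singletonD)
      obtain a b c where abc: "{a, b} \<in> edges ?F" "{a, c} \<in> edges ?F" "b \<noteq> c"
        using connected_cherry[OF assms(5) card3] .
      then have E: "{a, b} \<in> edges F" "{a, c} \<in> edges F" by (auto simp: delete_vertex_def)
      then have "{a, b} \<subseteq> verts F" "{a, c} \<subseteq> verts F" using assms(1) by (auto simp: simple_graph_def)
      with f(1) f(2)[OF E(1)] f(2)[OF E(2)] have "{a, b} = {a, c}" by (metis inj_on_image_eq_iff)
      with abc(3) show False by (auto simp: doubleton_eq_iff)
    qed
    moreover have "simple_graph G" using that by (auto simp: G_def simple_graph_def)
    ultimately show ?thesis using ex_number_ge[of G n F] by (simp add: G_def)
  qed
  \<comment> \<open>Write Z for the Zarankiewicz number, ex for the extremal number and e for the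
    number of edges. As \<open>n\<close> is at most Z, the counting bound gives 2e at most ex + 8Z,
    which is below (5/4) ex once 32Z is below ex; but e at least (3/4) ex makes 2e at least (3/2)
    ex.\<close>
  have "\<forall>\<^sub>F n in sequentially. real (?Z n) / real (ex_number n F) < 1 / 32"
    using order_tendstoD(2)[OF lim, of "1 / 32"] by simp
  then obtain N1 where N1: "\<And>n. n \<ge> N1 \<Longrightarrow> real (?Z n) / real (ex_number n F) < 1 / 32"
    by (auto simp: eventually_sequentially)
  have "bounded_with (1 / 2) (1 / 4) F"
    unfolding bounded_with_def
  \<comment> \<open>The three summands serve the limit, the doubling argument and the positivity of
    the extremal number.\<close>
  proof (intro exI[of _ "N1 + 2 * card (verts F) + 2"] allI impI, rule ccontr)
    fix n and G :: "nat ugraph"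
    assume n: "N1 + 2 * card (verts F) + 2 \<le> n" and G: "simple_graph G" "card (verts G) = n"
      and deg: "1 / 2 * (real n - 1) \<le> real (max_degree G)"
      and large: "(1 - 1 / 4) * real (ex_number n F) \<le> real (card (edges G))"
      and free: "\<not> contains_copy F G"
    have pos: "0 < ex_number n F" using ex_pos n by simp
    then have "32 * real (?Z n) < real (ex_number n F)" using N1[of n] n by (simp add: field_simps)
    moreover have "real (2 * card (edges G)) \<le> real (ex_number n F + 6 * ?Z n + 2 * n)"
      unfolding of_nat_le_iff
    proof (rule edge_bound_large_degree[OF G free _ _ _ assms(1) V assms(5)])
      from deg have "real n \<le> real (2 * max_degree G + 1)" by simp
      then show "n \<le> 2 * max_degree G + 1" by (rule of_nat_le_iff[THEN iffD1])
    qed (use n card3 in auto)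
    moreover have "real n \<le> real (?Z n)" using nZ by simp
    ultimately show False using large pos by simp
  qed
  then show ?thesis unfolding bounded_graph_def
    by (intro exI[of _ "1 / 2"] exI[of _ "1 / 4"]) auto
qed

end
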